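(* Fix arbitrary $0<\ell<\psi<\infty$. For $k\ge1$, let $\{\theta_j,\ 0\le j\le k\}$ be a sequence obtained by $\theta_{j+1}=T_\gamma(\theta_j;\alpha)$ for some $\gamma\in(0,\ell^2]$. Suppose that $\hat\theta\in\mathcal{M}_+(\ell,\psi)$ and $\theta_j\in\mathcal{M}_+(\ell,\psi)$ for $0\le j\le k$. Then $$\|\theta_k-\hat\theta\|_F^2\le\rho^k\|\theta_0-\hat\theta\|_F^2\quad\text{and}\quad \phi_\alpha(\theta_k)-\phi_\alpha(\hat\theta)\le\frac{\|\theta_0-\hat\theta\|_F^2}{2\gamma}\min\left\{\frac1k,\rho^k\right\},$$ where $\rho=1-\frac{\gamma}{\psi^2}$.
   Context: $\mathcal{M}$ is the set of real symmetric $p\times p$ matrices with inner product $\langle A,B\rangle=\mathrm{Tr}(A'B)$ and Frobenius norm $\|A\|_F$; $\mathcal{M}_+\subset\mathcal{M}$ is the set of positive definite matrices, and $\lambda_{\min},\lambda_{\max}$ denote smallest and largest eigenvalues. $S$ is a fixed $p\times p$ symmetric positive semidefinite matrix; $\lambda>0$ and $\alpha\in(0,1]$ are fixed. For $0<\ell\le\psi$, $\mathcal{M}_+(\ell,\psi)=\{\theta\in\mathcal{M}_+:\lambda_{\min}(\theta)\ge\ell,\ \lambda_{\max}(\theta)\le\psi\}$. Let $f(\theta)=-\log\det\theta+\mathrm{Tr}(\theta S)$ for $\theta\in\mathcal{M}_+$, $g_\alpha(\theta)=\sum_{i,j}\left(\alpha\lambda|\theta_{ij}|+\frac{1-\alpha}{2}\lambda\theta_{ij}^2\right)$,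 and $\phi_\alpha=f+g_\alpha$. $\hat\theta$ denotes the (unique) minimizer of $\phi_\alpha$ over $\mathcal{M}_+$. For $\gamma>0$ and $\theta\in\mathcal{M}_+$, $$T_\gamma(\theta;\alpha)=\operatorname{argmin}_{u\in\mathcal{M}}\left\{g_\alpha(u)+\frac{1}{2\gamma}\|u-\theta+\gamma(S-\theta^{-1})\|_F^2\right\}.$$ *)

theory Defs
  imports "HOL-Analysis.Analysis"
begin

text \<open>
  Real \<open>p \<times> p\<close> matrices are elements of \<open>real^'n^'n\<close> with \<open>p = CARD('n)\<close>. The library's inner
  product and norm on this type are the trace inner product and the Frobenius norm:
\<close>

lemma inner_matrix_eq_trace:
  fixes A B :: "real^'n^'n"
  shows "A \<bullet> B = trace (transpose A ** B)"
proof -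
  have "A \<bullet> B = (\<Sum>i\<in>UNIV. \<Sum>j\<in>UNIV. A $ i $ j * B $ i $ j)"
    by (simp add: inner_vec_def)
  also have "\<dots> = (\<Sum>j\<in>UNIV. \<Sum>i\<in>UNIV. A $ i $ j * B $ i $ j)"
    by (rule sum.swap)
  finally show ?thesis
    by (simp add: trace_def transpose_def matrix_matrix_mult_def)
qed

lemma norm_matrix_eq_frobenius:
  fixes A :: "real^'n^'n"
  shows "(norm A)\<^sup>2 = trace (transpose A ** A)"
  by (simp add: power2_norm_eq_inner inner_matrix_eq_trace)

definition sym_mats :: "(real^'n^'n) set" where
  "sym_mats = {A. transpose A = A}"

definition pd_mats :: "(real^'n^'n) set" where
  "pd_mats = {A \<in> sym_mats. \<forall>x. x \<noteq> 0 \<longrightarrow> 0 < x \<bullet> (A *v x)}"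

definition psd_mats :: "(real^'n^'n) set" where
  "psd_mats = {A \<in> sym_mats. \<forall>x. 0 \<le> x \<bullet> (A *v x)}"

definition eigenvalues :: "real^'n^'n \<Rightarrow> real set" where
  "eigenvalues A = {c. \<exists>v. v \<noteq> 0 \<and> A *v v = c *\<^sub>R v}"

text \<open>
  These are only meaningful where the set of real eigenvalues is finite and nonempty; symmetric
  matrices, to which they are applied below, satisfy this.
\<close>

definition lambda_min :: "real^'n^'n \<Rightarrow> real" where
  "lambda_min A = Min (eigenvalues A)"

definition lambda_max :: "real^'n^'n \<Rightarrow> real" where
  "lambda_max A = Max (eigenvalues A)"

definition pd_mats_between :: "real \<Rightarrow> real \<Rightarrow> (real^'n^'n) set" where
  "pd_mats_between l u = {\<theta> \<in> pd_mats. l \<le> lambda_min \<theta> \<and> lambda_max \<theta> \<le> u}"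

definition neg_loglik :: "real^'n^'n \<Rightarrow> real^'n^'n \<Rightarrow> real" where
  "neg_loglik S \<theta> = - ln (det \<theta>) + trace (\<theta> ** S)"

definition enet_penalty :: "real \<Rightarrow> real \<Rightarrow> real^'n^'n \<Rightarrow> real" where
  "enet_penalty lam \<alpha> \<theta> =
     (\<Sum>i\<in>UNIV. \<Sum>j\<in>UNIV.
        \<alpha> * lam * \<bar>\<theta> $ i $ j\<bar> + (1 - \<alpha>) / 2 * lam * (\<theta> $ i $ j)\<^sup>2)"

definition objective :: "real^'n^'n \<Rightarrow> real \<Rightarrow> real \<Rightarrow> real^'n^'n \<Rightarrow> real" where
  "objective S lam \<alpha> \<theta> = neg_loglik S \<theta> + enet_penalty lam \<alpha> \<theta>"

text \<open>
  The minimised function is strictly convex and coercive for \<open>lam \<ge> 0\<close>, \<open>0 \<le> \<alpha> \<le> 1\<close>, \<open>\<gamma> > 0\<close>,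
  so \<^const>\<open>arg_min_on\<close> picks its unique minimiser over the symmetric matrices.
\<close>

definition prox_step ::
    "real^'n^'n \<Rightarrow> real \<Rightarrow> real \<Rightarrow> real \<Rightarrow> real^'n^'n \<Rightarrow> real^'n^'n" where
  "prox_step S lam \<alpha> \<gamma> \<theta> =
     arg_min_on
       (\<lambda>u. enet_penalty lam \<alpha> u
            + 1 / (2 * \<gamma>) * (norm (u - \<theta> + \<gamma> *\<^sub>R (S - matrix_inv \<theta>)))\<^sup>2)
       sym_mats"

end

theory Submission
  imports Defs
begin

text \<open>
  On the symmetric matrices with spectrum in \<open>[l, \<psi>]\<close>, the smooth part of the objective is
  \<open>1 / \<psi>\<^sup>2\<close>-strongly convex with \<open>1 / l\<^sup>2\<close>-Lipschitz gradient \<open>S - \<theta>\<^sup>-\<^sup>1\<close>: along the segment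
  \<open>X t = A + t D\<close> the gradient gap is \<open>(A\<^sup>-\<^sup>1 - (X t)\<^sup>-\<^sup>1) \<bullet> D = t Tr (A\<^sup>-\<^sup>1 D (X t)\<^sup>-\<^sup>1 D)\<close>, and the bounds
  \<open>1 / \<psi> \<le> A\<^sup>-\<^sup>1, (X t)\<^sup>-\<^sup>1 \<le> 1 / l\<close> squeeze the trace. As \<open>\<gamma> \<le> l\<^sup>2\<close>, combining this with the
  \<open>1 / \<gamma>\<close>-strong convexity of the function minimised by the proximal step gives, for all \<open>u\<close> with
  spectrum in \<open>[l, \<psi>]\<close>,
  \<open>\<phi> (T \<theta>) - \<phi> u \<le> (\<rho> \<parallel>\<theta> - u\<parallel>\<^sup>2 - \<parallel>T \<theta> - u\<parallel>\<^sup>2) / (2 \<gamma>)\<close>. With \<open>u\<close> the minimiser this is the linear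
  rate; with \<open>u = \<theta>\<close> it shows that the objective decreases, and summation yields the \<open>1 / k\<close> rate.
\<close>

section \<open>Symmetric and positive semidefinite matrices\<close>

lemma sym_mats_inner:
  fixes A :: "real^'n^'n"
  assumes "A \<in> sym_mats"
  shows "x \<bullet> (A *v y) = (A *v x) \<bullet> y"
  using assms by (metis (mono_tags) dot_lmul_matrix mem_Collect_eq sym_mats_def transpose_matrix_vector)

lemma sym_mats_nth:
  assumes "A \<in> sym_mats"
  shows "A $ i $ j = A $ j $ i"
  using assms by (simp add: sym_mats_def transpose_def vec_eq_iff)

lemma subspace_sym_mats: "subspace sym_mats"
  by (auto simp: subspace_def sym_mats_def transpose_def vec_eq_iff)

lemma closed_sym_mats: "closed sym_mats"
  by (rule closed_subspace[OF subspace_sym_mats])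

lemma convex_sym_mats: "convex sym_mats"
  by (rule subspace_imp_convex[OF subspace_sym_mats])

text \<open>Moving from \<open>v\<close> along \<open>w = A *v v\<close> changes the form at first
  order by \<open>2 * t * (w \<bullet> w)\<close>, so a small negative \<open>t\<close> would make
  it negative unless \<open>w = 0\<close>.\<close>

lemma psd_mats_null_vector:
  fixes A :: "real^'n^'n"
  assumes A: "A \<in> psd_mats" and v: "v \<bullet> (A *v v) = 0"
  shows "A *v v = 0"
proof (rule ccontr)
  assume neq: "A *v v \<noteq> 0"
  define w where "w = A *v v"
  define a where "a = w \<bullet> w"
  define b where "b = w \<bullet> (A *v w)"
  have a: "a > 0" using neq by (simp add: a_def w_def)
  have b: "b \<ge> 0" using A by (simp add: b_def psd_mats_def)
  have sA: "A \<in> sym_mats" using A by (simp add: psd_mats_def)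
  have vw: "v \<bullet> (A *v w) = a"
    using sym_mats_inner[OF sA, of v w] by (simp add: a_def w_def)
  have *: "0 \<le> 2 * t * a + t\<^sup>2 * b" for t
  proof -
    have "0 \<le> (v + t *\<^sub>R w) \<bullet> (A *v (v + t *\<^sub>R w))"
      using A by (simp add: psd_mats_def)
    also have "\<dots> = v \<bullet> (A *v v) + t * (v \<bullet> (A *v w)) + t * (w \<bullet> (A *v v)) + t\<^sup>2 * b"
      by (simp add: matrix_vector_right_distrib matrix_vector_mult_scaleR inner_add_left
          inner_add_right b_def power2_eq_square algebra_simps)
    also have "\<dots> = 2 * t * a + t\<^sup>2 * b"
      using v vw by (simp add: a_def w_def)
    finally show ?thesis .
  qed
  \<comment> \<open>The quadratic in \<open>t\<close> is smallest at \<open>- a / b\<close>; the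
    denominator \<open>b + 1\<close> also covers \<open>b = 0\<close>.\<close>
  have "2 * (- a / (b + 1)) * a + (- a / (b + 1))\<^sup>2 * b = - (a\<^sup>2 * (b + 2)) / (b + 1)\<^sup>2"
    using b by (simp add: divide_simps) (simp add: algebra_simps power2_eq_square)
  also have "\<dots> < 0" using a b by simp
  finally show False using *[of "- a / (b + 1)"] by simp
qed

section \<open>Extreme eigenvalues as bounds on the quadratic form\<close>

lemma matrix_diff_mat_vector_mult:
  fixes A :: "real^'n^'n"
  shows "(A - mat c) *v x = A *v x - c *\<^sub>R x"
  by (simp add: vec_eq_iff matrix_vector_mult_def mat_def left_diff_distrib sum_subtractf if_distrib[of "\<lambda>a. a * _"] cong: if_cong)

lemma mat_in_sym_mats: "mat c \<in> sym_mats"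
  by (simp add: sym_mats_def)

text \<open>The Rayleigh quotient attains its minimum \<open>c\<close> on the unit sphere. There the
  form of the positive semidefinite matrix \<open>A - mat c\<close> vanishes, so the minimiser is an
  eigenvector.\<close>

lemma exists_eigenvalue_le_form:
  fixes A :: "real^'n^'n"
  assumes A: "A \<in> sym_mats"
  shows "\<exists>c \<in> eigenvalues A. \<forall>x. c * (x \<bullet> x) \<le> x \<bullet> (A *v x)"
proof -
  have "continuous_on (sphere 0 1) (\<lambda>x. x \<bullet> (A *v x))"
    by (intro continuous_intros matrix_vector_mult_linear_continuous_on)
  moreover have "sphere (0::real^'n) 1 \<noteq> {}" by simp
  ultimately obtain v where "v \<in> sphere 0 1"
    and min: "\<forall>x\<in>sphere 0 1. v \<bullet> (A *v v) \<le> x \<bullet> (A *v x)"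
    using continuous_attains_inf[OF compact_sphere] by blast
  then have v: "norm v = 1" by simp
  define c where "c = v \<bullet> (A *v v)"
  have le: "c * (x \<bullet> x) \<le> x \<bullet> (A *v x)" for x
  proof (cases "x = 0")
    case False
    have "c \<le> (x /\<^sub>R norm x) \<bullet> (A *v (x /\<^sub>R norm x))"
      unfolding c_def using False by (intro min[rule_format]) simp
    also have "\<dots> = (x \<bullet> (A *v x)) / (x \<bullet> x)"
      by (simp add: matrix_vector_mult_scaleR dot_square_norm power2_eq_square divide_inverse)
    finally show ?thesis using False by (simp add: field_simps)
  qed simp
  have psd: "A - mat c \<in> psd_mats"
    using A le subspace_diff[OF subspace_sym_mats A mat_in_sym_mats]
    by (simp add: psd_mats_def matrix_diff_mat_vector_mult inner_diff_right)
  have "v \<bullet> ((A - mat c) *v v) = 0"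
    using v by (simp add: matrix_diff_mat_vector_mult inner_diff_right c_def dot_square_norm)
  from psd_mats_null_vector[OF psd this] have "A *v v = c *\<^sub>R v"
    by (simp add: matrix_diff_mat_vector_mult)
  moreover have "v \<noteq> 0" using v by auto
  ultimately have "c \<in> eigenvalues A" unfolding eigenvalues_def by blast
  with le show ?thesis by blast
qed

text \<open>Eigenvectors of distinct eigenvalues are orthogonal, hence independent. Finiteness gives
  \<open>Min\<close> and \<open>Max\<close> in \<open>lambda_min\<close> and
  \<open>lambda_max\<close> their intended meaning.\<close>

lemma finite_eigenvalues:
  fixes A :: "real^'n^'n"
  assumes A: "A \<in> sym_mats"
  shows "finite (eigenvalues A)"
proof -
  obtain v where v: "\<And>c. c \<in> eigenvalues A \<Longrightarrow> v c \<noteq> 0 \<and> A *v v c = c *\<^sub>R v c"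
    using bchoice[of "eigenvalues A" "\<lambda>c v. v \<noteq> 0 \<and> A *v v = c *\<^sub>R v"]
    by (auto simp: eigenvalues_def)
  have orth: "v c \<bullet> v d = 0" if "c \<in> eigenvalues A" "d \<in> eigenvalues A" "c \<noteq> d" for c d
    using sym_mats_inner[OF A, of "v c" "v d"] v[OF that(1)] v[OF that(2)] that(3) by simp
  have inj: "inj_on v (eigenvalues A)"
  proof (rule inj_onI, rule ccontr)
    fix c d assume "c \<in> eigenvalues A" "d \<in> eigenvalues A" "v c = v d" "c \<noteq> d"
    with orth[of c d] v[of d] show False by simp
  qed
  have "pairwise orthogonal (v ` eigenvalues A)"
    using orth by (auto simp: pairwise_def orthogonal_def)
  moreover have "0 \<notin> v ` eigenvalues A" using v by force
  ultimately have "independent (v ` eigenvalues A)" by (rule pairwise_orthogonal_independent)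
  then show ?thesis using inj by (metis finite_imageD independent_imp_finite)
qed

lemma matrix_vector_mult_uminus_left: "(- A) *v x = - (A *v x)"
  for A :: "real^'n^'m"
  by (simp add: vec_eq_iff matrix_vector_mult_def sum_negf)

lemma eigenvalues_uminus_iff: "c \<in> eigenvalues (- A) \<longleftrightarrow> - c \<in> eigenvalues A"
  for A :: "real^'n^'n"
  unfolding eigenvalues_def
  by (simp add: matrix_vector_mult_uminus_left minus_equation_iff) (metis minus_equation_iff)

text \<open>Translates the spectral bounds into bounds on the form, which is how they enter all
  later estimates. The upper bound is the lower one for \<open>- A\<close>.\<close>

lemma pd_mats_between_form:
  fixes A :: "real^'n^'n"
  assumes "A \<in> pd_mats_between l u"
  shows "l * (x \<bullet> x) \<le> x \<bullet> (A *v x)" and "x \<bullet> (A *v x) \<le> u * (x \<bullet> x)"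
proof -
  have A: "A \<in> sym_mats" and l: "l \<le> Min (eigenvalues A)" and u: "Max (eigenvalues A) \<le> u"
    using assms by (auto simp: pd_mats_between_def pd_mats_def lambda_min_def lambda_max_def)
  note fin = finite_eigenvalues[OF A]
  obtain c where c: "c \<in> eigenvalues A" "c * (x \<bullet> x) \<le> x \<bullet> (A *v x)"
    using exists_eigenvalue_le_form[OF A] by blast
  then have "l \<le> c" using l Min_le[OF fin c(1)] by linarith
  then show "l * (x \<bullet> x) \<le> x \<bullet> (A *v x)"
    using c(2) mult_right_mono[of l c "x \<bullet> x"] by simp
  obtain d where d: "d \<in> eigenvalues (- A)" "d * (x \<bullet> x) \<le> x \<bullet> ((- A) *v x)"
    using exists_eigenvalue_le_form[OF subspace_neg[OF subspace_sym_mats A]] by blast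
  have "- d \<in> eigenvalues A" using d(1) by (simp add: eigenvalues_uminus_iff)
  then have "- d \<le> u" using u Max_ge[OF fin] by fastforce
  then show "x \<bullet> (A *v x) \<le> u * (x \<bullet> x)"
    using d(2) mult_right_mono[of "- d" u "x \<bullet> x"] by (simp add: matrix_vector_mult_uminus_left)
qed

text \<open>
  Eliminating a nonzero diagonal entry of \<open>P\<close> splits off a rank-one positive semidefinite summand
  and leaves a positive semidefinite Schur complement with fewer nonzero rows.
\<close>

lemma inner_psd_mats_nonneg:
  fixes P Q :: "real^'n^'n"
  assumes "P \<in> psd_mats" and Q: "Q \<in> psd_mats"
  shows "0 \<le> P \<bullet> Q"
  using assms(1)
proof (induction "card {i. P $ i \<noteq> 0}" arbitrary: P rule: less_induct)
  case less
  note P = \<open>P \<in> psd_mats\<close>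
  have sP: "P \<in> sym_mats" using P by (simp add: psd_mats_def)
  have ax: "P *v axis i 1 = P $ i" for i
    using sym_mats_nth[OF sP] by (simp add: matrix_vector_mult_basis column_def vec_eq_iff)
  show ?case
  proof (cases "\<exists>i. P $ i $ i \<noteq> 0")
    case False
    then have "P $ i = 0" for i
      \<comment> \<open>A zero diagonal entry makes the basis vector a zero of the form, so the
        whole row vanishes.\<close>
      using psd_mats_null_vector[OF P, of "axis i 1"] by (simp add: ax inner_axis')
    then have "P = 0" by (simp add: vec_eq_iff)
    then show ?thesis by simp
  next
    case True
    then obtain i where i: "P $ i $ i \<noteq> 0" by blast
    define c where "c = P $ i $ i"
    have "c \<ge> 0"
      using P[unfolded psd_mats_def] by (auto dest: spec[of _ "axis i 1"] simp: c_def ax inner_axis')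
    with i have c: "c > 0" by (simp add: c_def)
    define R where "R = (\<chi> j k. P $ j $ k - P $ i $ j * P $ i $ k / c)"
    have Rv: "R *v x = P *v x - ((P $ i \<bullet> x) / c) *\<^sub>R P $ i" for x
      by (simp add: vec_eq_iff R_def matrix_vector_mult_def inner_vec_def left_diff_distrib
          right_diff_distrib sum_subtractf sum_distrib_left sum_divide_distrib mult_ac)
    have "R \<in> sym_mats"
      using sym_mats_nth[OF sP] by (simp add: sym_mats_def transpose_def R_def vec_eq_iff mult.commute)
    moreover have "0 \<le> x \<bullet> (R *v x)" for x
    proof -
      \<comment> \<open>This \<open>s\<close> minimises the form of \<open>P\<close> along
        \<open>x - s *\<^sub>R axis i 1\<close>; the minimum is the form of the Schur complement
        \<open>R\<close> at \<open>x\<close>.\<close>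
      define s where "s = (P $ i \<bullet> x) / c"
      have "0 \<le> (x - s *\<^sub>R axis i 1) \<bullet> (P *v (x - s *\<^sub>R axis i 1))"
        using P by (simp add: psd_mats_def)
      also have "P *v (x - s *\<^sub>R axis i 1) = P *v x - s *\<^sub>R P $ i"
        by (simp add: matrix_vector_mult_diff_distrib matrix_vector_mult_scaleR ax)
      also have "(x - s *\<^sub>R axis i 1) \<bullet> (P *v x - s *\<^sub>R P $ i)
          = x \<bullet> (P *v x) - 2 * s * (P $ i \<bullet> x) + s\<^sup>2 * c"
        using sym_mats_inner[OF sP, of "axis i 1" x]
        by (simp add: inner_diff_left inner_diff_right ax inner_axis' c_def inner_commute
            power2_eq_square)
      also have "\<dots> = x \<bullet> (R *v x)"
        using c by (simp add: Rv inner_diff_right s_def power2_eq_square inner_commute field_simps)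
      finally show ?thesis .
    qed
    ultimately have R: "R \<in> psd_mats" by (simp add: psd_mats_def)
    have "R $ i = 0" using c by (simp add: R_def vec_eq_iff c_def)
    moreover have "R $ j = 0" if "P $ j = 0" for j
      using that sym_mats_nth[OF sP, of i j] by (simp add: R_def vec_eq_iff)
    moreover have "P $ i \<noteq> 0" using i by auto
    ultimately have "{j. R $ j \<noteq> 0} \<subset> {j. P $ j \<noteq> 0}" by auto
    then have "0 \<le> R \<bullet> Q" by (intro less.hyps R psubset_card_mono) simp_all
    \<comment> \<open>The last term is the inner product of \<open>Q\<close> with the rank-one
      summand \<open>P - R\<close>.\<close>
    moreover have "P \<bullet> Q = R \<bullet> Q + (P $ i \<bullet> (Q *v (P $ i))) / c"
      by (simp add: inner_vec_def R_def matrix_vector_mult_def left_diff_distrib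
          right_diff_distrib sum_subtractf sum_distrib_left sum_divide_distrib mult_ac)
    moreover have "0 \<le> (P $ i \<bullet> (Q *v (P $ i))) / c"
      using Q c by (simp add: psd_mats_def)
    ultimately show ?thesis by simp
  qed
qed

section \<open>Inverses and trace inequalities\<close>

lemma matrix_add_rdistrib: "(A + B) ** C = A ** C + B ** C"
  for A B :: "'a::semiring_1^'n^'m"
  by (simp add: matrix_matrix_mult_def vec_eq_iff distrib_right sum.distrib)

lemma matrix_inv_inverse:
  fixes A :: "real^'n^'n"
  assumes "invertible A"
  shows "A ** matrix_inv A = mat 1" "matrix_inv A ** A = mat 1"
  using someI_ex[OF assms[unfolded invertible_def]] by (simp_all add: matrix_inv_def)

lemma invertible_if_form_pos:
  fixes A :: "real^'n^'n"
  assumes "0 < a" and lower: "\<And>x. a * (x \<bullet> x) \<le> x \<bullet> (A *v x)"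
  shows "invertible A"
  unfolding invertible_left_inverse matrix_left_invertible_ker
proof (intro allI impI)
  fix x assume "A *v x = 0"
  then show "x = 0"
    using lower[of x] mult_pos_pos[OF \<open>0 < a\<close>, of "x \<bullet> x"] by force
qed

lemma matrix_inv_sym_mats:
  fixes A :: "real^'n^'n"
  assumes "A \<in> sym_mats" "invertible A"
  shows "matrix_inv A \<in> sym_mats"
proof -
  note inv = matrix_inv_inverse[OF assms(2)]
  have "transpose (matrix_inv A) ** A = mat 1"
    using arg_cong[OF inv(1), of transpose] assms(1)
    by (simp add: matrix_transpose_mul sym_mats_def)
  then have "transpose (matrix_inv A) = matrix_inv A"
    by (metis inv(1) matrix_mul_assoc matrix_mul_lid matrix_mul_rid)
  then show ?thesis by (simp add: sym_mats_def)
qed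

text \<open>With \<open>y = matrix_inv A *v x\<close>, each bound comes from expanding a nonnegative
  quantity: the form of \<open>A\<close> at \<open>y - (1 / b) *\<^sub>R x\<close> for the first,
  the squared norm of \<open>x - a *\<^sub>R y\<close> for the second.\<close>

lemma matrix_inv_form_bounds:
  fixes A :: "real^'n^'n"
  assumes A: "A \<in> sym_mats" and "0 < a"
    and lower: "\<And>x. a * (x \<bullet> x) \<le> x \<bullet> (A *v x)"
    and upper: "\<And>x. x \<bullet> (A *v x) \<le> b * (x \<bullet> x)" and "0 < b"
  shows "1 / b * (x \<bullet> x) \<le> x \<bullet> (matrix_inv A *v x)"
    and "x \<bullet> (matrix_inv A *v x) \<le> 1 / a * (x \<bullet> x)"
proof -
  define y where "y = matrix_inv A *v x"
  have Ay: "A *v y = x"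
    using matrix_inv_inverse(1)[OF invertible_if_form_pos[OF \<open>0 < a\<close> lower]]
    by (simp add: y_def matrix_vector_mul_assoc)
  have form: "(y - s *\<^sub>R x) \<bullet> (A *v (y - s *\<^sub>R x))
      = x \<bullet> y - 2 * s * (x \<bullet> x) + s\<^sup>2 * (x \<bullet> (A *v x))" for s
    using sym_mats_inner[OF A, of y x]
    by (simp add: matrix_vector_mult_diff_distrib matrix_vector_mult_scaleR Ay inner_diff_left
        inner_diff_right power2_eq_square inner_commute algebra_simps)
  have "0 \<le> a * ((y - (1 / b) *\<^sub>R x) \<bullet> (y - (1 / b) *\<^sub>R x))" using \<open>0 < a\<close> by simp
  also note lower
  also note form
  also have "x \<bullet> y - 2 * (1 / b) * (x \<bullet> x) + (1 / b)\<^sup>2 * (x \<bullet> (A *v x))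
      \<le> x \<bullet> y - 2 * (1 / b) * (x \<bullet> x) + (1 / b)\<^sup>2 * (b * (x \<bullet> x))"
    by (intro add_left_mono mult_left_mono upper) simp
  also have "\<dots> = x \<bullet> y - 1 / b * (x \<bullet> x)"
    using \<open>0 < b\<close> by (simp add: power2_eq_square)
  finally show "1 / b * (x \<bullet> x) \<le> x \<bullet> (matrix_inv A *v x)" by (simp add: y_def)
  have "0 \<le> (x - a *\<^sub>R y) \<bullet> (x - a *\<^sub>R y)" by simp
  also have "\<dots> = x \<bullet> x - 2 * a * (x \<bullet> y) + a * (a * (y \<bullet> y))"
    by (simp add: inner_diff_left inner_diff_right inner_commute)
  also have "\<dots> \<le> x \<bullet> x - 2 * a * (x \<bullet> y) + a * (x \<bullet> y)"
    using lower[of y] \<open>0 < a\<close> by (simp add: Ay inner_commute)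
  finally show "x \<bullet> (matrix_inv A *v x) \<le> 1 / a * (x \<bullet> x)"
    using \<open>0 < a\<close> by (simp add: y_def field_simps)
qed

lemma inner_mat_left: "mat c \<bullet> Q = c * trace Q"
  for Q :: "real^'n^'n"
  by (simp add: inner_vec_def trace_def mat_def sum_distrib_left if_distrib[of "\<lambda>a. a * _"] cong: if_cong)

text \<open>Subtracting \<open>mat a\<close> from \<open>P\<close>, or \<open>P\<close> from
  \<open>mat b\<close>, leaves a positive semidefinite matrix, whose inner product with
  \<open>Q\<close> is nonnegative; multiples of the identity pair with \<open>Q\<close> to multiples
  of its trace.\<close>

lemma inner_psd_mats_bounds:
  fixes P Q :: "real^'n^'n"
  assumes P: "P \<in> sym_mats" and Q: "Q \<in> psd_mats"
  shows "(\<And>x. a * (x \<bullet> x) \<le> x \<bullet> (P *v x)) \<Longrightarrow> a * trace Q \<le> P \<bullet> Q"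
    and "(\<And>x. x \<bullet> (P *v x) \<le> b * (x \<bullet> x)) \<Longrightarrow> P \<bullet> Q \<le> b * trace Q"
proof -
  assume lower: "\<And>x. a * (x \<bullet> x) \<le> x \<bullet> (P *v x)"
  have "P - mat a \<in> psd_mats"
    using lower subspace_diff[OF subspace_sym_mats P mat_in_sym_mats]
    by (simp add: psd_mats_def matrix_diff_mat_vector_mult inner_diff_right)
  from inner_psd_mats_nonneg[OF this Q] show "a * trace Q \<le> P \<bullet> Q"
    by (simp add: inner_diff_left inner_mat_left)
next
  assume upper: "\<And>x. x \<bullet> (P *v x) \<le> b * (x \<bullet> x)"
  have "(mat b - P) *v x = b *\<^sub>R x - P *v x" for x
    using matrix_diff_mat_vector_mult[of P b x] matrix_vector_mult_uminus_left[of "P - mat b" x]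
    by simp
  then have "mat b - P \<in> psd_mats"
    using upper subspace_diff[OF subspace_sym_mats mat_in_sym_mats P]
    by (simp add: psd_mats_def inner_diff_right)
  from inner_psd_mats_nonneg[OF this Q] show "P \<bullet> Q \<le> b * trace Q"
    by (simp add: inner_diff_left inner_mat_left)
qed

text \<open>The trace bounds are applied twice: replacing \<open>P\<close> by a multiple of the
  identity leaves \<open>trace (D ** Q ** D) = Q \<bullet> (D ** D)\<close>, and replacing
  \<open>Q\<close> then leaves \<open>trace (D ** D)\<close>. The intended \<open>P\<close> and
  \<open>Q\<close> are inverses of matrices on a segment.\<close>

lemma inner_congruence_bounds:
  fixes P Q D :: "real^'n^'n"
  assumes P: "P \<in> sym_mats" and Q: "Q \<in> sym_mats" and D: "D \<in> sym_mats" and "0 \<le> a"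
    and lower: "\<And>x. a * (x \<bullet> x) \<le> x \<bullet> (P *v x)" "\<And>x. a * (x \<bullet> x) \<le> x \<bullet> (Q *v x)"
    and upper: "\<And>x. x \<bullet> (P *v x) \<le> b * (x \<bullet> x)" "\<And>x. x \<bullet> (Q *v x) \<le> b * (x \<bullet> x)" and "0 \<le> b"
  shows "a\<^sup>2 * (norm D)\<^sup>2 \<le> P \<bullet> (D ** Q ** D)" and "P \<bullet> (D ** Q ** D) \<le> b\<^sup>2 * (norm D)\<^sup>2"
proof -
  have tD: "transpose D = D" using D by (simp add: sym_mats_def)
  have DD: "D ** R ** D \<in> psd_mats" if "R \<in> sym_mats" "\<And>x. 0 \<le> x \<bullet> (R *v x)" for R
  proof -
    have "x \<bullet> ((D ** R ** D) *v x) = (D *v x) \<bullet> (R *v (D *v x))" for x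
      using sym_mats_inner[OF D, of x "R *v (D *v x)"] by (simp add: matrix_vector_mul_assoc matrix_mul_assoc)
    moreover have "D ** R ** D \<in> sym_mats"
      using that(1) tD by (simp add: sym_mats_def matrix_transpose_mul matrix_mul_assoc)
    ultimately show ?thesis using that(2) by (simp add: psd_mats_def)
  qed
  have "0 \<le> x \<bullet> (Q *v x)" for x
    by (rule order.trans[OF _ lower(2)]) (simp add: \<open>0 \<le> a\<close>)
  note DQD = DD[OF Q this]
  have "D ** D \<in> psd_mats" using DD[OF mat_in_sym_mats, of 1] by simp
  note DD = this
  have tr: "trace (D ** Q ** D) = Q \<bullet> (D ** D)"
    using Q trace_mul_sym[of "D ** Q" D] trace_mul_sym[of "D ** D" Q]
    by (simp add: inner_matrix_eq_trace sym_mats_def matrix_mul_assoc)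
  have tr2: "trace (D ** D) = (norm D)\<^sup>2"
    by (simp add: norm_matrix_eq_frobenius tD)
  show "a\<^sup>2 * (norm D)\<^sup>2 \<le> P \<bullet> (D ** Q ** D)"
  proof -
    have "a * (a * trace (D ** D)) \<le> a * trace (D ** Q ** D)"
      unfolding tr using inner_psd_mats_bounds(1)[OF Q DD lower(2)] \<open>0 \<le> a\<close> by (rule mult_left_mono)
    also have "\<dots> \<le> P \<bullet> (D ** Q ** D)"
      by (rule inner_psd_mats_bounds(1)[OF P DQD lower(1)])
    finally show ?thesis by (simp add: tr2 power2_eq_square mult.assoc)
  qed
  show "P \<bullet> (D ** Q ** D) \<le> b\<^sup>2 * (norm D)\<^sup>2"
  proof -
    have "P \<bullet> (D ** Q ** D) \<le> b * trace (D ** Q ** D)"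
      by (rule inner_psd_mats_bounds(2)[OF P DQD upper(1)])
    also have "\<dots> \<le> b * (b * trace (D ** D))"
      unfolding tr using inner_psd_mats_bounds(2)[OF Q DD upper(2)] \<open>0 \<le> b\<close> by (rule mult_left_mono)
    finally show ?thesis by (simp add: tr2 power2_eq_square mult.assoc)
  qed
qed

section \<open>Quadratic bounds for the log-determinant\<close>

text \<open>In the Leibniz expansion a permutation other than \<open>id\<close> moves at least two
  points. Differentiating one factor therefore leaves a vanishing off-diagonal entry of the
  identity, and only \<open>id\<close> contributes.\<close>

lemma has_field_derivative_det_mat1:
  fixes M :: "real^'n^'n"
  shows "((\<lambda>s. det (mat 1 + s *\<^sub>R M)) has_field_derivative trace M) (at 0)"
proof -
  have zero: "(\<Prod>j\<in>UNIV - {i}. (mat 1 :: real^'n^'n) $ j $ p j) = 0"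
    if p: "p permutes UNIV" and "p \<noteq> id" for p i
  proof -
    obtain j where j: "p j \<noteq> j" using \<open>p \<noteq> id\<close> by (auto simp: fun_eq_iff)
    \<comment> \<open>If \<open>j\<close> is moved, so is \<open>p j\<close> by injectivity, and one
      of the two differs from \<open>i\<close>.\<close>
    have "\<exists>j. j \<noteq> i \<and> p j \<noteq> j"
      using j permutes_inj[OF p] by (metis injD)
    then obtain j where "j \<in> UNIV - {i}" "j \<noteq> p j" by force
    then show ?thesis by (intro prod_zero) (auto simp: mat_def)
  qed
  have "((\<lambda>s. det (mat 1 + s *\<^sub>R M)) has_field_derivative
      (\<Sum>p | p permutes UNIV. of_int (sign p) *
        (\<Sum>i\<in>UNIV. M $ i $ p i * (\<Prod>j\<in>UNIV - {i}. (mat 1 + 0 *\<^sub>R M) $ j $ p j)))) (at 0)"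
    unfolding det_def
    by (intro DERIV_sum DERIV_cmult has_field_derivative_prod) (auto intro!: derivative_eq_intros)
  also have "(\<Sum>p | p permutes UNIV. of_int (sign p) *
        (\<Sum>i\<in>UNIV. M $ i $ p i * (\<Prod>j\<in>UNIV - {i}. (mat 1 + 0 *\<^sub>R M) $ j $ p j)))
      = (\<Sum>p\<in>{id}. of_int (sign p) *
        (\<Sum>i\<in>UNIV. M $ i $ p i * (\<Prod>j\<in>UNIV - {i}. (mat 1 :: real^'n^'n) $ j $ p j)))"
    by (intro sum.mono_neutral_cong_right) (auto simp: zero permutes_id)
  also have "\<dots> = trace M" by (simp add: trace_def mat_def)
  finally show ?thesis .
qed

text \<open>
  The library's \<^term>\<open>ln\<close> satisfies \<open>ln (- x) = ln x\<close>, so the sign of a determinant is irrelevant below.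
\<close>

lemma DERIV_ln_nonzero:
  assumes "x \<noteq> 0"
  shows "(ln has_field_derivative inverse x) (at (x::real))"
proof (cases "x > 0")
  case False
  then have "((\<lambda>x. ln (- x)) has_field_derivative inverse x) (at x)"
    using assms by (auto intro!: derivative_eq_intros simp: divide_inverse)
  then show ?thesis by (simp add: ln_minus)
qed (rule DERIV_ln)

text \<open>Factoring out \<open>X = A + t *\<^sub>R D\<close> and using multiplicativity of
  \<open>det\<close> reduces the claim to the derivative at the identity.\<close>

lemma has_field_derivative_ln_det_line:
  fixes A D :: "real^'n^'n"
  assumes inv: "invertible (A + t *\<^sub>R D)"
  shows "((\<lambda>s. ln (det (A + s *\<^sub>R D))) has_field_derivative
    trace (matrix_inv (A + t *\<^sub>R D) ** D)) (at t)"
proof -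
  define X where "X = A + t *\<^sub>R D"
  define M where "M = matrix_inv X ** D"
  have X: "det X \<noteq> 0" using inv by (simp add: X_def invertible_det_nz)
  have "A + s *\<^sub>R D = X ** (mat 1 + (s - t) *\<^sub>R M)" for s
  proof -
    have "X ** (mat 1 + (s - t) *\<^sub>R M) = X + (s - t) *\<^sub>R (X ** M)"
      by (simp add: matrix_add_ldistrib matrix_scalar_ac scalar_matrix_assoc)
    also have "X ** M = D"
      using matrix_inv_inverse(1)[OF inv] by (simp add: M_def matrix_mul_assoc X_def)
    finally show ?thesis by (simp add: X_def algebra_simps)
  qed
  then have eq: "det (A + s *\<^sub>R D) = det X * det (mat 1 + (s - t) *\<^sub>R M)" for s
    by (simp add: det_mul)
  have "((\<lambda>s. det (mat 1 + (s - t) *\<^sub>R M)) has_field_derivative trace M * 1) (at t)"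
    by (rule DERIV_chain2[where f = "\<lambda>s. det (mat 1 + s *\<^sub>R M)"])
       (auto intro!: derivative_eq_intros has_field_derivative_det_mat1)
  from DERIV_cmult[OF this, of "det X"]
  have "((\<lambda>s. det (A + s *\<^sub>R D)) has_field_derivative det X * trace M) (at t)"
    by (simp add: eq)
  from DERIV_chain2[OF DERIV_ln_nonzero this] X
  show ?thesis by (simp add: X_def[symmetric] M_def[symmetric] field_simps)
qed

text \<open>The bounded quantity is the Bregman divergence of \<open>- ln det\<close> at
  \<open>B\<close> relative to \<open>A\<close>. Bounds on the gradient gap, linear in
  \<open>t\<close>, integrate along the segment to the quadratic bounds.\<close>

lemma ln_det_bregman_bounds:
  fixes A B :: "real^'n^'n"
  assumes A: "A \<in> sym_mats" and B: "B \<in> sym_mats" and "0 < l" "0 < u"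
    and lower: "\<And>x. l * (x \<bullet> x) \<le> x \<bullet> (A *v x)" "\<And>x. l * (x \<bullet> x) \<le> x \<bullet> (B *v x)"
    and upper: "\<And>x. x \<bullet> (A *v x) \<le> u * (x \<bullet> x)" "\<And>x. x \<bullet> (B *v x) \<le> u * (x \<bullet> x)"
  shows "1 / (2 * u\<^sup>2) * (norm (B - A))\<^sup>2 \<le> ln (det A) - ln (det B) + matrix_inv A \<bullet> (B - A)"
    and "ln (det A) - ln (det B) + matrix_inv A \<bullet> (B - A) \<le> 1 / (2 * l\<^sup>2) * (norm (B - A))\<^sup>2"
proof -
  define D where "D = B - A"
  define X where "X t = A + t *\<^sub>R D" for t
  have D: "D \<in> sym_mats" unfolding D_def by (rule subspace_diff[OF subspace_sym_mats B A])
  have X: "X t \<in> sym_mats" for t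
    unfolding X_def by (intro subspace_add[OF subspace_sym_mats] subspace_mul[OF subspace_sym_mats] A D)
  have Xform: "x \<bullet> (X t *v x) = (1 - t) * (x \<bullet> (A *v x)) + t * (x \<bullet> (B *v x))" for t x
    by (simp add: X_def D_def matrix_vector_mult_add_rdistrib matrix_vector_mult_diff_rdistrib
        scaleR_matrix_vector_assoc[symmetric] inner_add_right inner_diff_right algebra_simps)
  have Xlower: "l * (x \<bullet> x) \<le> x \<bullet> (X t *v x)" if "0 \<le> t" "t \<le> 1" for t x
    using add_mono[OF mult_left_mono[OF lower(1)[of x], of "1 - t"] mult_left_mono[OF lower(2)[of x], of t]] that
    by (simp add: Xform algebra_simps)
  have Xupper: "x \<bullet> (X t *v x) \<le> u * (x \<bullet> x)" if "0 \<le> t" "t \<le> 1" for t x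
    using add_mono[OF mult_left_mono[OF upper(1)[of x], of "1 - t"] mult_left_mono[OF upper(2)[of x], of t]] that
    by (simp add: Xform algebra_simps)
  have inv: "invertible (X t)" if "0 \<le> t" "t \<le> 1" for t
    by (rule invertible_if_form_pos[OF \<open>0 < l\<close> Xlower[OF that]])
  have X0: "X 0 = A" by (simp add: X_def)
  \<comment> \<open>This is the resolvent identity \<open>P - Q = t *\<^sub>R (P ** D ** Q)\<close>
    paired with \<open>D\<close>, after a cyclic shift under the trace.\<close>
  have gap: "matrix_inv A \<bullet> D - matrix_inv (X t) \<bullet> D = t * (matrix_inv A \<bullet> (D ** matrix_inv (X t) ** D))"
    if t: "0 \<le> t" "t \<le> 1" for t
  proof -
    define P where "P = matrix_inv A"
    define Q where "Q = matrix_inv (X t)"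
    have invA: "invertible A" using inv[of 0] by (simp add: X0)
    note P = matrix_inv_inverse[OF invA, folded P_def] matrix_inv_sym_mats[OF A invA, folded P_def]
    note Q = matrix_inv_inverse[OF inv[OF t], folded Q_def] matrix_inv_sym_mats[OF X inv[OF t], folded Q_def]
    have "P = P ** (X t ** Q)" using Q(1) by simp
    also have "\<dots> = P ** A ** Q + t *\<^sub>R (P ** D ** Q)"
      by (simp add: X_def matrix_add_ldistrib matrix_add_rdistrib matrix_mul_assoc
          matrix_scalar_ac scalar_matrix_assoc)
    finally have "P = Q + t *\<^sub>R (P ** D ** Q)" using P(2) by simp
    then have "P - Q = t *\<^sub>R (P ** D ** Q)" by (metis add_diff_cancel_left')
    then have "(P - Q) \<bullet> D = t * ((P ** D ** Q) \<bullet> D)" by simp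
    also have "(P ** D ** Q) \<bullet> D = P \<bullet> (D ** Q ** D)"
      using P(3) Q(3) D trace_mul_sym[of "Q ** D" "P ** D"]
      by (simp add: inner_matrix_eq_trace sym_mats_def matrix_transpose_mul matrix_mul_assoc)
    finally show ?thesis by (simp add: P_def Q_def inner_diff_left)
  qed
  have gap_bounds: "1 / u\<^sup>2 * (norm D)\<^sup>2 * t \<le> matrix_inv A \<bullet> D - matrix_inv (X t) \<bullet> D"
    "matrix_inv A \<bullet> D - matrix_inv (X t) \<bullet> D \<le> 1 / l\<^sup>2 * (norm D)\<^sup>2 * t"
    if t: "0 \<le> t" "t \<le> 1" for t
  proof -
    have invA: "invertible A" using inv[of 0] by (simp add: X0)
    note bounds = inner_congruence_bounds[OF matrix_inv_sym_mats[OF A invA]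
        matrix_inv_sym_mats[OF X inv[OF t]] D, of "1 / u" "1 / l",
        OF _ matrix_inv_form_bounds(1)[OF A \<open>0 < l\<close> lower(1) upper(1) \<open>0 < u\<close>]
        matrix_inv_form_bounds(1)[OF X \<open>0 < l\<close> Xlower[OF t] Xupper[OF t] \<open>0 < u\<close>]
        matrix_inv_form_bounds(2)[OF A \<open>0 < l\<close> lower(1) upper(1) \<open>0 < u\<close>]
        matrix_inv_form_bounds(2)[OF X \<open>0 < l\<close> Xlower[OF t] Xupper[OF t] \<open>0 < u\<close>]]
    show "1 / u\<^sup>2 * (norm D)\<^sup>2 * t \<le> matrix_inv A \<bullet> D - matrix_inv (X t) \<bullet> D"
      using mult_left_mono[OF bounds(1) t(1)] \<open>0 < l\<close> \<open>0 < u\<close> by (simp add: gap[OF t] power_divide mult.commute)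
    show "matrix_inv A \<bullet> D - matrix_inv (X t) \<bullet> D \<le> 1 / l\<^sup>2 * (norm D)\<^sup>2 * t"
      using mult_left_mono[OF bounds(2) t(1)] \<open>0 < l\<close> \<open>0 < u\<close> by (simp add: gap[OF t] power_divide mult.commute)
  qed
  have deriv: "((\<lambda>s. ln (det (X s))) has_field_derivative matrix_inv (X t) \<bullet> D) (at t)"
    if t: "0 \<le> t" "t \<le> 1" for t
    using has_field_derivative_ln_det_line[of A t D] inv[OF t] matrix_inv_sym_mats[OF X inv[OF t]]
    by (simp add: X_def inner_matrix_eq_trace sym_mats_def)
  have X1: "X 1 = B" by (simp add: X_def D_def)
  \<comment> \<open>The derivative of \<open>g\<close> is the gradient gap, and its increment over
    the unit interval is the divergence.\<close>
  define g where "g t = t * (matrix_inv A \<bullet> D) - ln (det (X t))" for t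
  have g_deriv: "(g has_field_derivative matrix_inv A \<bullet> D - matrix_inv (X t) \<bullet> D) (at t)"
    if "0 \<le> t" "t \<le> 1" for t
    unfolding g_def[abs_def] by (rule derivative_eq_intros deriv[OF that] refl | simp)+
  have g_gap: "g 1 - g 0 = ln (det A) - ln (det B) + matrix_inv A \<bullet> (B - A)"
    by (simp add: g_def X0 X1 D_def)
  \<comment> \<open>The subtracted quadratic has the lower bound of the gap as its derivative, so
    \<open>p\<close> is nondecreasing; \<open>q\<close> below treats the upper bound in the same
    way.\<close>
  define p where "p t = g t - 1 / (2 * u\<^sup>2) * (norm D)\<^sup>2 * t\<^sup>2" for t
  have "p 0 \<le> p 1"
  proof (rule DERIV_nonneg_imp_nondecreasing[where f = p])
    fix t :: real assume t: "0 \<le> t" "t \<le> 1"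
    have "(p has_field_derivative (matrix_inv A \<bullet> D - matrix_inv (X t) \<bullet> D
        - 1 / u\<^sup>2 * (norm D)\<^sup>2 * t)) (at t)"
      unfolding p_def[abs_def] by (rule derivative_eq_intros g_deriv[OF t] refl | simp)+
    moreover have "0 \<le> matrix_inv A \<bullet> D - matrix_inv (X t) \<bullet> D - 1 / u\<^sup>2 * (norm D)\<^sup>2 * t"
      using gap_bounds(1)[OF t] by simp
    ultimately show "\<exists>y. (p has_field_derivative y) (at t) \<and> 0 \<le> y" by blast
  qed simp
  then show "1 / (2 * u\<^sup>2) * (norm (B - A))\<^sup>2 \<le> ln (det A) - ln (det B) + matrix_inv A \<bullet> (B - A)"
    unfolding g_gap[symmetric] by (simp add: p_def D_def)
  define q where "q t = 1 / (2 * l\<^sup>2) * (norm D)\<^sup>2 * t\<^sup>2 - g t" for t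
  have "q 0 \<le> q 1"
  proof (rule DERIV_nonneg_imp_nondecreasing[where f = q])
    fix t :: real assume t: "0 \<le> t" "t \<le> 1"
    have "(q has_field_derivative (1 / l\<^sup>2 * (norm D)\<^sup>2 * t
        - (matrix_inv A \<bullet> D - matrix_inv (X t) \<bullet> D))) (at t)"
      unfolding q_def[abs_def] by (rule derivative_eq_intros g_deriv[OF t] refl | simp)+
    moreover have "0 \<le> 1 / l\<^sup>2 * (norm D)\<^sup>2 * t - (matrix_inv A \<bullet> D - matrix_inv (X t) \<bullet> D)"
      using gap_bounds(2)[OF t] by simp
    ultimately show "\<exists>y. (q has_field_derivative y) (at t) \<and> 0 \<le> y" by blast
  qed simp
  then show "ln (det A) - ln (det B) + matrix_inv A \<bullet> (B - A) \<le> 1 / (2 * l\<^sup>2) * (norm (B - A))\<^sup>2"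
    unfolding g_gap[symmetric] by (simp add: q_def D_def)
qed

text \<open>The trace term is linear, so \<open>neg_loglik S\<close> has the same Bregman divergence
  as \<open>- ln det\<close>; \<open>G\<close> is its gradient at \<open>A\<close>.\<close>

lemma neg_loglik_quadratic_bounds:
  fixes S A B :: "real^'n^'n"
  assumes A: "A \<in> pd_mats_between l u" and B: "B \<in> pd_mats_between l u" and "0 < l" "0 < u"
  defines "G \<equiv> S - matrix_inv A"
  shows "neg_loglik S A + G \<bullet> (B - A) + 1 / (2 * u\<^sup>2) * (norm (B - A))\<^sup>2 \<le> neg_loglik S B"
    and "neg_loglik S B \<le> neg_loglik S A + G \<bullet> (B - A) + 1 / (2 * l\<^sup>2) * (norm (B - A))\<^sup>2"
proof -
  have sym: "A \<in> sym_mats" "B \<in> sym_mats"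
    using A B by (auto simp: pd_mats_between_def pd_mats_def)
  then have tr: "trace (A ** S) = S \<bullet> A" "trace (B ** S) = S \<bullet> B"
    using inner_matrix_eq_trace[of A S] inner_matrix_eq_trace[of B S]
    by (simp_all add: sym_mats_def inner_commute)
  note bounds = ln_det_bregman_bounds[OF sym \<open>0 < l\<close> \<open>0 < u\<close>
      pd_mats_between_form(1)[OF A] pd_mats_between_form(1)[OF B]
      pd_mats_between_form(2)[OF A] pd_mats_between_form(2)[OF B]]
  show "neg_loglik S A + G \<bullet> (B - A) + 1 / (2 * u\<^sup>2) * (norm (B - A))\<^sup>2 \<le> neg_loglik S B"
    "neg_loglik S B \<le> neg_loglik S A + G \<bullet> (B - A) + 1 / (2 * l\<^sup>2) * (norm (B - A))\<^sup>2"
    using bounds by (simp_all add: neg_loglik_def tr G_def inner_diff_left inner_diff_right)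
qed

section \<open>The proximal step\<close>

text \<open>Subgradients are avoided by comparing \<open>v\<close> with points of the segment
  towards \<open>u\<close>: the squared norm contributes a strong convexity term of order
  \<open>t\<close>, so dividing by \<open>t\<close> and letting \<open>t\<close> tend to 0 gives the
  growth term with full constant \<open>c\<close>.\<close>

lemma is_arg_min_prox_growth:
  fixes g :: "'a::real_inner \<Rightarrow> real"
  assumes g: "convex_on C g" and "0 \<le> c"
    and min: "is_arg_min (\<lambda>u. g u + c * (norm (u - z))\<^sup>2) (\<lambda>u. u \<in> C) v" and u: "u \<in> C"
  shows "g v + c * (norm (v - z))\<^sup>2 + c * (norm (u - v))\<^sup>2 \<le> g u + c * (norm (u - z))\<^sup>2"
proof -
  define q where "q u = g u + c * (norm (u - z))\<^sup>2" for u
  have v: "v \<in> C" and qmin: "\<And>w. w \<in> C \<Longrightarrow> q v \<le> q w"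
    using min by (auto simp: is_arg_min_linorder q_def)
  have "c * (norm (u - v))\<^sup>2 * (1 - t) \<le> q u - q v" if t: "0 < t" "t < 1" for t
  proof -
    have "(1 - t) *\<^sub>R v + t *\<^sub>R u \<in> C"
      using convexD_alt[OF convex_on_imp_convex[OF g] v u] t by simp
    from qmin[OF this]
    have "q v \<le> g ((1 - t) *\<^sub>R v + t *\<^sub>R u) + c * (norm ((1 - t) *\<^sub>R v + t *\<^sub>R u - z))\<^sup>2"
      by (simp add: q_def)
    also have "\<dots> \<le> (1 - t) * g v + t * g u + c * (norm ((1 - t) *\<^sub>R v + t *\<^sub>R u - z))\<^sup>2"
      using convex_onD[OF g, of t v u] v u t by simp
    \<comment> \<open>For the squared norm the convexity defect is exact, so no constant is lost in
      the limit.\<close>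
    also have "(norm ((1 - t) *\<^sub>R v + t *\<^sub>R u - z))\<^sup>2
        = (1 - t) * (norm (v - z))\<^sup>2 + t * (norm (u - z))\<^sup>2 - t * (1 - t) * (norm (u - v))\<^sup>2"
    proof -
      have eq: "(1 - t) *\<^sub>R v + t *\<^sub>R u - z = (1 - t) *\<^sub>R (v - z) + t *\<^sub>R (u - z)" "u - v = (u - z) - (v - z)"
        by (simp_all add: algebra_simps)
      show ?thesis
        unfolding eq power2_norm_eq_inner
        by (simp add: inner_add_left inner_add_right inner_diff_left inner_diff_right inner_commute algebra_simps)
    qed
    finally have "t * (c * (norm (u - v))\<^sup>2 * (1 - t)) \<le> t * (q u - q v)"
      by (simp add: q_def algebra_simps)
    then show ?thesis using t by simp
  qed
  then have "\<forall>\<^sub>F t in at_right 0. c * (norm (u - v))\<^sup>2 * (1 - t) \<le> q u - q v"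
    by (auto simp: eventually_at_right_field intro!: exI[of _ 1])
  moreover have "((\<lambda>t. c * (norm (u - v))\<^sup>2 * (1 - t)) \<longlongrightarrow> c * (norm (u - v))\<^sup>2 * (1 - 0)) (at_right 0)"
    by (intro tendsto_intros)
  ultimately have "c * (norm (u - v))\<^sup>2 * (1 - 0) \<le> q u - q v"
    by (intro tendsto_upperbound[where F = "at_right (0::real)"]) auto
  then show ?thesis by (simp add: q_def)
qed

lemma enet_penalty_nonneg:
  assumes "0 \<le> lam" "0 \<le> \<alpha>" "\<alpha> \<le> 1"
  shows "0 \<le> enet_penalty lam \<alpha> \<theta>"
  unfolding enet_penalty_def using assms by (intro sum_nonneg add_nonneg_nonneg mult_nonneg_nonneg) auto

lemma continuous_on_enet_penalty: "continuous_on C (enet_penalty lam \<alpha>)"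
  unfolding enet_penalty_def[abs_def] by (intro continuous_intros)

lemma convex_on_enet_penalty:
  assumes "0 \<le> lam" "0 \<le> \<alpha>" "\<alpha> \<le> 1" and "convex C"
  shows "convex_on C (enet_penalty lam \<alpha> :: real^'n^'n \<Rightarrow> real)"
proof
  fix t :: real and x y :: "real^'n^'n"
  assume t: "0 < t" "t < 1"
  define h where "h r = \<alpha> * lam * \<bar>r\<bar> + (1 - \<alpha>) / 2 * lam * r\<^sup>2" for r
  have h: "h ((1 - t) * r + t * s) \<le> (1 - t) * h r + t * h s" for r s
  proof -
    have "\<bar>(1 - t) * r + t * s\<bar> \<le> (1 - t) * \<bar>r\<bar> + t * \<bar>s\<bar>"
      using t abs_triangle_ineq[of "(1 - t) * r" "t * s"] by (simp add: abs_mult)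
    moreover have "((1 - t) * r + t * s)\<^sup>2 \<le> (1 - t) * r\<^sup>2 + t * s\<^sup>2"
      using convex_onD[OF convex_power2, of t r s] t by simp
    ultimately have "h ((1 - t) * r + t * s) \<le> \<alpha> * lam * ((1 - t) * \<bar>r\<bar> + t * \<bar>s\<bar>)
        + (1 - \<alpha>) / 2 * lam * ((1 - t) * r\<^sup>2 + t * s\<^sup>2)"
      unfolding h_def using assms by (intro add_mono mult_left_mono) auto
    also have "\<dots> = (1 - t) * h r + t * h s"
      by (simp add: h_def field_simps)
    finally show ?thesis .
  qed
  have eq: "enet_penalty lam \<alpha> x = (\<Sum>i\<in>UNIV. \<Sum>j\<in>UNIV. h (x $ i $ j))" for x :: "real^'n^'n"
    by (simp add: enet_penalty_def h_def)
  show "enet_penalty lam \<alpha> ((1 - t) *\<^sub>R x + t *\<^sub>R y) \<le> (1 - t) * enet_penalty lam \<alpha> x + t * enet_penalty lam \<alpha> y"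
    unfolding eq sum_distrib_left sum.distrib[symmetric] by (intro sum_mono) (simp add: h)
qed fact

text \<open>\<open>arg_min_on\<close> is a choice operator, so existence of a minimiser has to be
  established. As the penalty is nonnegative and vanishes at 0, points farther from \<open>z\<close>
  than 0 is cannot beat 0, and compactness handles the rest.\<close>

lemma is_arg_min_prox_step:
  fixes S \<theta> :: "real^'n^'n"
  assumes "0 \<le> lam" "0 \<le> \<alpha>" "\<alpha> \<le> 1" "0 < \<gamma>"
  shows "is_arg_min (\<lambda>u. enet_penalty lam \<alpha> u
            + 1 / (2 * \<gamma>) * (norm (u - \<theta> + \<gamma> *\<^sub>R (S - matrix_inv \<theta>)))\<^sup>2) (\<lambda>u. u \<in> sym_mats)
          (prox_step S lam \<alpha> \<gamma> \<theta>)"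
proof -
  define q where "q u = enet_penalty lam \<alpha> u
            + 1 / (2 * \<gamma>) * (norm (u - \<theta> + \<gamma> *\<^sub>R (S - matrix_inv \<theta>)))\<^sup>2" for u
  define z where "z = \<theta> - \<gamma> *\<^sub>R (S - matrix_inv \<theta>)"
  have q: "q u = enet_penalty lam \<alpha> u + 1 / (2 * \<gamma>) * (norm (u - z))\<^sup>2" for u
    by (simp add: q_def z_def algebra_simps)
  have q0: "q 0 = 1 / (2 * \<gamma>) * (norm z)\<^sup>2" by (simp add: q enet_penalty_def)
  \<comment> \<open>The radius is the distance from \<open>z\<close> to 0, so that the comparison
    point 0 belongs to \<open>K\<close>.\<close>
  define K where "K = cball z (norm z) \<inter> sym_mats"
  have "compact K" unfolding K_def by (intro compact_Int_closed compact_cball closed_sym_mats)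
  moreover have K0: "0 \<in> K" by (simp add: K_def subspace_0[OF subspace_sym_mats])
  moreover have "continuous_on K q"
    unfolding q by (intro continuous_intros continuous_on_enet_penalty)
  ultimately obtain v where v: "v \<in> K" "\<And>u. u \<in> K \<Longrightarrow> q v \<le> q u"
    using continuous_attains_inf[of K q] by blast
  have "q v \<le> q u" if u: "u \<in> sym_mats" for u
  proof (cases "u \<in> K")
    case False
    then have "norm z \<le> norm (u - z)" using u by (simp add: K_def dist_norm norm_minus_commute)
    then have "(norm z)\<^sup>2 \<le> (norm (u - z))\<^sup>2" by (simp add: power_mono)
    then have "q 0 \<le> 1 / (2 * \<gamma>) * (norm (u - z))\<^sup>2"
      unfolding q0 using \<open>0 < \<gamma>\<close> by (intro mult_left_mono) auto
    also have "\<dots> \<le> q u" using enet_penalty_nonneg[OF assms(1-3)] by (simp add: q)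
    finally show ?thesis using v(2)[OF K0] by simp
  qed (rule v)
  then have "is_arg_min q (\<lambda>u. u \<in> sym_mats) v"
    using v(1) by (auto simp: is_arg_min_linorder K_def)
  then have "is_arg_min q (\<lambda>u. u \<in> sym_mats) (arg_min_on q sym_mats)"
    unfolding arg_min_on_def arg_min_def by (rule someI)
  then show ?thesis by (simp add: q_def[abs_def] prox_step_def)
qed

text \<open>The upper quadratic bound is used from \<open>\<theta>\<close> to the new point and the
  lower one from \<open>\<theta>\<close> to \<open>u\<close>; adding the growth inequality of the
  proximal step cancels the gradient terms. The curvature in the lower bound produces the factor
  \<open>1 - \<gamma> / \<psi>\<^sup>2\<close>.\<close>

lemma prox_step_objective_le:
  fixes S \<theta> u :: "real^'n^'n"
  assumes "0 \<le> lam" "0 \<le> \<alpha>" "\<alpha> \<le> 1" "0 < \<gamma>" and \<gamma>: "\<gamma> \<le> l\<^sup>2" and "0 < l" "0 < \<psi>"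
    and \<theta>: "\<theta> \<in> pd_mats_between l \<psi>" and u: "u \<in> pd_mats_between l \<psi>"
    and \<theta>': "prox_step S lam \<alpha> \<gamma> \<theta> \<in> pd_mats_between l \<psi>"
  shows "objective S lam \<alpha> (prox_step S lam \<alpha> \<gamma> \<theta>) - objective S lam \<alpha> u
    \<le> 1 / (2 * \<gamma>) * ((1 - \<gamma> / \<psi>\<^sup>2) * (norm (\<theta> - u))\<^sup>2 - (norm (prox_step S lam \<alpha> \<gamma> \<theta> - u))\<^sup>2)"
proof -
  define v where "v = prox_step S lam \<alpha> \<gamma> \<theta>"
  define G where "G = S - matrix_inv \<theta>"
  have uS: "u \<in> sym_mats" using u by (simp add: pd_mats_between_def pd_mats_def)
  \<comment> \<open>Up to a term independent of \<open>w\<close>, the proximal square is the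
    linearisation of the smooth part at \<open>\<theta>\<close> plus a quadratic in the distance to
    \<open>\<theta>\<close>.\<close>
  have expand: "1 / (2 * \<gamma>) * (norm (w - (\<theta> - \<gamma> *\<^sub>R G)))\<^sup>2
      = 1 / (2 * \<gamma>) * (norm (w - \<theta>))\<^sup>2 + G \<bullet> (w - \<theta>) + \<gamma> / 2 * (norm G)\<^sup>2" for w
  proof -
    have "w - (\<theta> - \<gamma> *\<^sub>R G) = (w - \<theta>) + \<gamma> *\<^sub>R G" by simp
    then have "(norm (w - (\<theta> - \<gamma> *\<^sub>R G)))\<^sup>2 = (norm (w - \<theta>))\<^sup>2 + 2 * \<gamma> * (G \<bullet> (w - \<theta>)) + \<gamma>\<^sup>2 * (norm G)\<^sup>2"
      by (simp only: power2_norm_eq_inner)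
        (simp add: inner_add_left inner_add_right inner_commute power2_eq_square algebra_simps)
    then show ?thesis using \<open>0 < \<gamma>\<close> by (simp add: field_simps power2_eq_square)
  qed
  have "is_arg_min (\<lambda>u. enet_penalty lam \<alpha> u + 1 / (2 * \<gamma>) * (norm (u - (\<theta> - \<gamma> *\<^sub>R G)))\<^sup>2)
      (\<lambda>u. u \<in> sym_mats) v"
    using is_arg_min_prox_step[OF assms(1-4), of \<theta> S] by (simp add: v_def G_def algebra_simps)
  from is_arg_min_prox_growth[OF convex_on_enet_penalty[OF assms(1-3) convex_sym_mats] _ this uS]
  have prox: "enet_penalty lam \<alpha> v + 1 / (2 * \<gamma>) * (norm (v - \<theta>))\<^sup>2 + G \<bullet> (v - \<theta>)
      + 1 / (2 * \<gamma>) * (norm (u - v))\<^sup>2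
      \<le> enet_penalty lam \<alpha> u + 1 / (2 * \<gamma>) * (norm (u - \<theta>))\<^sup>2 + G \<bullet> (u - \<theta>)"
    using \<open>0 < \<gamma>\<close> unfolding expand by simp
  \<comment> \<open>Here the step size restriction enters: the quadratic of the proximal step
    dominates the one in the upper bound.\<close>
  have "1 / (2 * l\<^sup>2) * (norm (v - \<theta>))\<^sup>2 \<le> 1 / (2 * \<gamma>) * (norm (v - \<theta>))\<^sup>2"
    using \<gamma> \<open>0 < \<gamma>\<close> \<open>0 < l\<close> by (intro mult_right_mono divide_left_mono) auto
  with neg_loglik_quadratic_bounds(2)[OF \<theta> \<theta>' \<open>0 < l\<close> \<open>0 < \<psi>\<close>, of S]
  have "neg_loglik S v \<le> neg_loglik S \<theta> + G \<bullet> (v - \<theta>) + 1 / (2 * \<gamma>) * (norm (v - \<theta>))\<^sup>2"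
    by (simp add: v_def G_def)
  moreover have "neg_loglik S \<theta> + G \<bullet> (u - \<theta>) + 1 / (2 * \<psi>\<^sup>2) * (norm (u - \<theta>))\<^sup>2 \<le> neg_loglik S u"
    using neg_loglik_quadratic_bounds(1)[OF \<theta> u \<open>0 < l\<close> \<open>0 < \<psi>\<close>, of S] by (simp add: G_def)
  ultimately have "objective S lam \<alpha> v - objective S lam \<alpha> u
      \<le> 1 / (2 * \<gamma>) * (norm (u - \<theta>))\<^sup>2 - 1 / (2 * \<psi>\<^sup>2) * (norm (u - \<theta>))\<^sup>2 - 1 / (2 * \<gamma>) * (norm (u - v))\<^sup>2"
    using prox by (simp add: objective_def)
  also have "\<dots> = 1 / (2 * \<gamma>) * ((1 - \<gamma> / \<psi>\<^sup>2) * (norm (u - \<theta>))\<^sup>2 - (norm (u - v))\<^sup>2)"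
    using \<open>0 < \<gamma>\<close> \<open>0 < \<psi>\<close> by (simp add: field_simps)
  finally show ?thesis by (simp add: v_def norm_minus_commute)
qed

section \<open>Convergence rates of the iteration\<close>

theorem theorem3:
  fixes S \<theta>hat :: "real^'n^'n"
    and \<theta> :: "nat \<Rightarrow> real^'n^'n"
    and lam \<alpha> l \<psi> \<gamma> \<rho> :: real
    and k :: nat
  assumes "S \<in> psd_mats"
    and "0 < lam"
    and "0 < \<alpha>" and "\<alpha> \<le> 1"
    and "is_arg_min (objective S lam \<alpha>) (\<lambda>\<tau>. \<tau> \<in> pd_mats) \<theta>hat"
    and "0 < l" and "l < \<psi>"
    and "1 \<le> k"
    and "0 < \<gamma>" and "\<gamma> \<le> l\<^sup>2"
    and "\<And>j. j < k \<Longrightarrow> \<theta> (Suc j) = prox_step S lam \<alpha> \<gamma> (\<theta> j)"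
    and "\<theta>hat \<in> pd_mats_between l \<psi>"
    and "\<And>j. j \<le> k \<Longrightarrow> \<theta> j \<in> pd_mats_between l \<psi>"
    and "\<rho> = 1 - \<gamma> / \<psi>\<^sup>2"
  shows "(norm (\<theta> k - \<theta>hat))\<^sup>2 \<le> \<rho> ^ k * (norm (\<theta> 0 - \<theta>hat))\<^sup>2
    \<and> objective S lam \<alpha> (\<theta> k) - objective S lam \<alpha> \<theta>hat
        \<le> (norm (\<theta> 0 - \<theta>hat))\<^sup>2 / (2 * \<gamma>) * min (1 / real k) (\<rho> ^ k)"
proof -
  define d where "d j = (norm (\<theta> j - \<theta>hat))\<^sup>2" for j
  define e where "e j = objective S lam \<alpha> (\<theta> j) - objective S lam \<alpha> \<theta>hat" for j
  have "l\<^sup>2 \<le> \<psi>\<^sup>2" using \<open>0 < l\<close> \<open>l < \<psi>\<close> by (simp add: power_mono)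
  then have "\<gamma> \<le> \<psi>\<^sup>2" using \<open>\<gamma> \<le> l\<^sup>2\<close> by linarith
  \<comment> \<open>Nonnegativity of \<open>\<rho>\<close> allows inequalities to be multiplied by
    it; \<open>\<rho> \<le> 1\<close> is what lets the distances telescope.\<close>
  then have \<rho>: "0 \<le> \<rho>" "\<rho> \<le> 1"
    using \<open>0 < \<gamma>\<close> \<open>0 < l\<close> \<open>l < \<psi>\<close> by (simp_all add: assms(14))
  have step: "objective S lam \<alpha> (\<theta> (Suc j)) - objective S lam \<alpha> u
      \<le> 1 / (2 * \<gamma>) * (\<rho> * (norm (\<theta> j - u))\<^sup>2 - (norm (\<theta> (Suc j) - u))\<^sup>2)"
    if j: "j < k" and u: "u \<in> pd_mats_between l \<psi>" for j u
    unfolding assms(14) assms(11)[OF j]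
  proof (rule prox_step_objective_le[OF _ _ assms(4,9,10,6) _ _ u])
    show "prox_step S lam \<alpha> \<gamma> (\<theta> j) \<in> pd_mats_between l \<psi>"
      using assms(13)[of "Suc j"] j by (simp add: assms(11))
  qed (use assms(2,3,6,7) assms(13)[of j] j in simp_all)
  have e_nonneg: "0 \<le> e j" if "j \<le> k" for j
    using assms(5) assms(13)[OF that] by (simp add: e_def is_arg_min_linorder pd_mats_between_def)
  have e_step: "2 * \<gamma> * e (Suc j) \<le> \<rho> * d j - d (Suc j)" if "j < k" for j
    using step[OF that assms(12)] \<open>0 < \<gamma>\<close> by (simp add: d_def e_def field_simps)
  \<comment> \<open>With \<open>u = \<theta> j\<close> the first distance in \<open>step\<close>
    vanishes.\<close>
  have e_decr: "e (Suc j) \<le> e j" if j: "j < k" for j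
  proof -
    have "objective S lam \<alpha> (\<theta> (Suc j)) - objective S lam \<alpha> (\<theta> j) \<le> - (1 / (2 * \<gamma>) * (norm (\<theta> (Suc j) - \<theta> j))\<^sup>2)"
      using step[OF j assms(13)[of j]] j by simp
    also have "\<dots> \<le> 0" using \<open>0 < \<gamma>\<close> by simp
    finally show ?thesis by (simp add: e_def)
  qed
  have d_le: "d j \<le> \<rho> ^ j * d 0" if "j \<le> k" for j
    using that
  proof (induction j)
    case (Suc j)
    have "0 \<le> 2 * \<gamma> * e (Suc j)" using e_nonneg[OF Suc.prems] \<open>0 < \<gamma>\<close> by simp
    then have "d (Suc j) \<le> \<rho> * d j" using e_step[of j] Suc.prems by simp
    also have "\<dots> \<le> \<rho> * (\<rho> ^ j * d 0)" using Suc \<rho>(1) by (intro mult_left_mono) auto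
    finally show ?case by simp
  qed simp
  \<comment> \<open>The telescoped sum of the gaps is bounded below by its number of terms times the
    latest gap, since the gaps decrease.\<close>
  have sum_bound: "real j * (2 * \<gamma> * e j) \<le> d 0 - d j" if "j \<le> k" for j
    using that
  proof (induction j)
    case (Suc j)
    have "real j * (2 * \<gamma> * e (Suc j)) \<le> real j * (2 * \<gamma> * e j)"
      using e_decr[of j] Suc.prems \<open>0 < \<gamma>\<close> by (intro mult_left_mono) auto
    moreover have "\<rho> * d j \<le> d j" using \<rho>(2) mult_right_mono[of \<rho> 1 "d j"] by (simp add: d_def)
    ultimately show ?case using e_step[of j] Suc by (simp add: algebra_simps)
  qed simp
  \<comment> \<open>The gap after the last step is bounded by \<open>\<rho>\<close> times the
    distance before it; with the rate for \<open>m = k - 1\<close> this yields the full power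
    \<open>\<rho> ^ k\<close>.\<close>
  obtain m where m: "k = Suc m" using \<open>1 \<le> k\<close> by (cases k) auto
  have "2 * \<gamma> * e k \<le> \<rho> * d m - d k" using e_step[of m] m by simp
  also have "\<dots> \<le> \<rho> * d m" by (simp add: d_def)
  also have "\<dots> \<le> \<rho> * (\<rho> ^ m * d 0)" using d_le[of m] m \<rho>(1) by (intro mult_left_mono) auto
  finally have "e k \<le> d 0 / (2 * \<gamma>) * \<rho> ^ k" using \<open>0 < \<gamma>\<close> m by (simp add: field_simps)
  moreover have "real k * (2 * \<gamma> * e k) \<le> d 0"
    using sum_bound[of k] zero_le_power2[of "norm (\<theta> k - \<theta>hat)"] unfolding d_def by linarith
  then have "e k \<le> d 0 / (2 * \<gamma>) * (1 / real k)" using \<open>0 < \<gamma>\<close> \<open>1 \<le> k\<close> by (simp add: field_simps)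
  ultimately have "e k \<le> d 0 / (2 * \<gamma>) * min (1 / real k) (\<rho> ^ k)"
    unfolding min_def by presburger
  with d_le[of k] show ?thesis by (simp add: d_def e_def)
qed

end
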